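(* Let $M,L,N\ge 1$ be integers, $\boldsymbol p=(p_1,\dots,p_M)$ a tuple of nonnegative integers, and $\mathcal J_{M,\boldsymbol p}=\{\boldsymbol\alpha=(\alpha_1,\dots,\alpha_M):\ \alpha_m\in\{0,\dots,p_m\},\ m=1,\dots,M\}$ the full multi-index set. Suppose the polynomial chaos coefficients of the diffusion coefficient $\kappa$ are given in the tensor train (TT) format $$\kappa(x,\boldsymbol\alpha)=\sum_{\ell=0}^{L}\sum_{s_1=1}^{r_1}\cdots\sum_{s_{M-1}=1}^{r_{M-1}}\kappa^{(0)}_\ell(x)\,\boldsymbol\kappa^{(1)}_{\ell,s_1}(\alpha_1)\,\boldsymbol\kappa^{(2)}_{s_1,s_2}(\alpha_2)\cdots\boldsymbol\kappa^{(M)}_{s_{M-1}}(\alpha_M),\qquad \boldsymbol\alpha\in\mathcal J_{M,\boldsymbol p},$$ with TT ranks $r_0=L+1$ (for the index $\ell$) and $r_1,\dots,r_{M-1}$, where $\kappa^{(0)}_0=\bar\kappa$, $\kappa^{(0)}_\ell=v_\ell$ for $\ell=1,\dots,L$, and the tensors $$\tilde{\boldsymbol\kappa}_\ell(\boldsymbol\alpha)=\sum_{s_1,\dots,s_{M-1}}\boldsymbol\kappa^{(1)}_{\ell,s_1}(\alpha_1)\boldsymbol\kappa^{(2)}_{s_1,s_2}(\alpha_2)\cdots\boldsymbol\kappa^{(M)}_{s_{M-1}}(\alpha_M),\qquad \ell=0,\dots,L,$$ satisfy $\tilde{\boldsymbol\kappa}_0(\boldsymbol\alpha)=1$ if $\boldsymbol\alpha=(0,\dots,0)$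 and $\tilde{\boldsymbol\kappa}_0(\boldsymbol\alpha)=0$ otherwise. Then the stochastic Galerkin matrix $$\mathbf K=\boldsymbol K^{(x)}_0\otimes\boldsymbol\Delta_0+\sum_{\ell=1}^{L}\boldsymbol K^{(x)}_\ell\otimes\boldsymbol K^{(\omega)}_\ell\in\mathbb R^{(N\cdot\#\mathcal J_{M,\boldsymbol p})\times(N\cdot\#\mathcal J_{M,\boldsymbol p})}$$ (with $\boldsymbol K^{(x)}_\ell$, $\boldsymbol\Delta_0$, $\boldsymbol K^{(\omega)}_\ell$ as defined in the context) can be written in the TT format with the same ranks: there exist matrices $\boldsymbol K^{(0)}_{\ell}\in\mathbb R^{N\times N}$ ($\ell=0,\dots,L$) and $\boldsymbol K^{(m)}_{s_{m-1},s_m}\in\mathbb R^{(p_m+1)\times(p_m+1)}$, $m=1,\dots,M$ (where $s_0=\ell\in\{0,\dots,L\}$, $s_m\in\{1,\dots,r_m\}$ for $1\le m\le M-1$, and the index $s_M$ is absent), such that $$\mathbf K=\sum_{\ell=0}^{L}\sum_{s_1=1}^{r_1}\cdots\sum_{s_{M-1}=1}^{r_{M-1}}\boldsymbol K^{(0)}_\ell\otimes\boldsymbol K^{(1)}_{\ell,s_1}\otimes\boldsymbol K^{(2)}_{s_1,s_2}\otimes\cdots\otimes\boldsymbol K^{(M)}_{s_{M-1}}.$$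
   Context: Setting: the elliptic equation $-\nabla\cdot(\kappa\nabla u)=f$ on a domain $D\subset\mathbb R^d$ with a random coefficient $\kappa$, discretized by a stochastic Galerkin method. Spatial part: $\varphi_1,\dots,\varphi_N$ are finite element basis functions on $D$; $\bar\kappa(x)$ and $v_1(x),\dots,v_L(x)$ are given real functions on $D$ (the mean and the truncated Karhunen-Loève basis functions of $\kappa$), such that all the integrals below are finite. For $i,j=1,\dots,N$, $$\boldsymbol K^{(x)}_0(i,j)=\int_D\bar\kappa(x)\,\nabla\varphi_i(x)\cdot\nabla\varphi_j(x)\,dx,\qquad \boldsymbol K^{(x)}_\ell(i,j)=\int_D v_\ell(x)\,\nabla\varphi_i(x)\cdot\nabla\varphi_j(x)\,dx,\quad \ell=1,\dots,L.$$ Stochastic part: $h_n$ denotes the $n$-th univariate (probabilists') Hermite polynomial, orthogonal with respect to $\rho(\theta)=\frac{1}{\sqrt{2\pi}}e^{-\theta^2/2}$ with $\int_{\mathbb R} h_n^2\rho\,d\theta=n!$. Triple products: $$\Delta_{a,b,c}=\int_{\mathbb R}h_a(\theta)h_b(\theta)h_c(\theta)\rho(\theta)\,d\theta,\qquad \boldsymbol\Delta_{\boldsymbol\alpha,\boldsymbol\beta,\boldsymbol\nu}=\prod_{m=1}^M\Delta_{\alpha_m,\beta_m,\nu_m}.$$ For $\boldsymbol\alpha,\boldsymbol\beta\in\mathcal J_{M,\boldsymbol p}$, $$\boldsymbol\Delta_0(\boldsymbol\alpha,\boldsymbol\beta)=\prod_{m=1}^M\Delta_{\alpha_m,\beta_m,0},\qquad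 \boldsymbol K^{(\omega)}_\ell(\boldsymbol\alpha,\boldsymbol\beta)=\sum_{\boldsymbol\nu\in\mathcal J_{M,\boldsymbol p}}\boldsymbol\Delta_{\boldsymbol\alpha,\boldsymbol\beta,\boldsymbol\nu}\,\tilde{\boldsymbol\kappa}_\ell(\boldsymbol\nu),\quad \ell=1,\dots,L.$$ Conventions: $\otimes$ is the Kronecker product, with rows and columns of $\mathbf K$ indexed by $(i,\boldsymbol\alpha)$ and $(j,\boldsymbol\beta)$; thus a term $A^{(0)}\otimes A^{(1)}\otimes\cdots\otimes A^{(M)}$ has entries $A^{(0)}(i,j)\prod_{m=1}^M A^{(m)}(\alpha_m,\beta_m)$. The TT blocks $\boldsymbol\kappa^{(m)}_{s_{m-1},s_m}(\alpha_m)$ are real numbers, with $s_m$ ranging over $\{1,\dots,r_m\}$ for $1\le m\le M-1$, and $\ell$ playing the role of the index $s_0$. The TT ranks are the numbers of values of the summation indices ($L+1$ for $\ell$ and $r_m$ for $s_m$). *)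

theory Defs
  imports "HOL-Probability.Probability" "HOL-Computational_Algebra.Polynomial"
begin

(* Junk value where f is not differentiable; finite element functions are
   differentiable almost everywhere, so integrals do not see these points. *)
definition grad :: "('a::real_inner \<Rightarrow> real) \<Rightarrow> 'a \<Rightarrow> 'a" where
  "grad f x = (THE g. GDERIV f x :> g)"

lemma grad_eqI:
  assumes "GDERIV f x :> g"
  shows "grad f x = g"
proof -
  have "g' = g" if "GDERIV f x :> g'" for g'
  proof -
    have "(\<lambda>h. inner h g') = (\<lambda>h. inner h g)"
      using that assms unfolding gderiv_def by (rule has_derivative_unique)
    then have "inner h g' = inner h g" for h
      by meson
    then show ?thesis
      using vector_eq_ldot by blast
  qed
  then show ?thesis
    unfolding grad_def using assms by blast
qed

(* Matrices are functions of a row and a column index, where the index sets are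
   {1..N}, {0..p m}, the multi-index set, or products of these. *)

definition stiffness ::
  "('a::euclidean_space) set \<Rightarrow> (nat \<Rightarrow> 'a \<Rightarrow> real) \<Rightarrow> ('a \<Rightarrow> real) \<Rightarrow> nat \<Rightarrow> nat \<Rightarrow> real" where
  "stiffness D \<phi> c i j =
     set_lebesgue_integral lebesgue D (\<lambda>x. c x * (grad (\<phi> i) x \<bullet> grad (\<phi> j) x))"

(* Multi-indices are extensional functions on {1..M}. *)
definition multi_indices :: "nat \<Rightarrow> (nat \<Rightarrow> nat) \<Rightarrow> (nat \<Rightarrow> nat) set" where
  "multi_indices M p = (\<Pi>\<^sub>E m\<in>{1..M}. {0..p m})"

(* Probabilists' normalisation: monic, with squared norm n! under the standard
   normal density. *)
fun hermite :: "nat \<Rightarrow> real poly" where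
  "hermite 0 = 1"
| "hermite (Suc 0) = [:0, 1:]"
| "hermite (Suc (Suc n)) = [:0, 1:] * hermite (Suc n) - smult (of_nat (Suc n)) (hermite n)"

definition triple_product :: "nat \<Rightarrow> nat \<Rightarrow> nat \<Rightarrow> real" where
  "triple_product a b c =
     (LINT \<theta>|lborel. poly (hermite a) \<theta> * poly (hermite b) \<theta> * poly (hermite c) \<theta>
                     * std_normal_density \<theta>)"

definition triple_product_multi ::
  "nat \<Rightarrow> (nat \<Rightarrow> nat) \<Rightarrow> (nat \<Rightarrow> nat) \<Rightarrow> (nat \<Rightarrow> nat) \<Rightarrow> real" where
  "triple_product_multi M \<alpha> \<beta> \<nu> = (\<Prod>m=1..M. triple_product (\<alpha> m) (\<beta> m) (\<nu> m))"

definition Delta0 :: "nat \<Rightarrow> (nat \<Rightarrow> nat) \<Rightarrow> (nat \<Rightarrow> nat) \<Rightarrow> real" where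
  "Delta0 M \<alpha> \<beta> = (\<Prod>m=1..M. triple_product (\<alpha> m) (\<beta> m) 0)"

(* Values of the summation indices (s_1, ..., s_(M-1)). *)
definition tt_indices :: "nat \<Rightarrow> (nat \<Rightarrow> nat) \<Rightarrow> (nat \<Rightarrow> nat) set" where
  "tt_indices M r = (\<Pi>\<^sub>E m\<in>{1..M-1}. {1..r m})"

(* The m-th block selected by s_0 = l and s.  The last block has no right index,
   so it is passed separately as H; for M = 1 it is the only block, and its left
   index is l. *)
definition tt_block ::
  "nat \<Rightarrow> (nat \<Rightarrow> nat \<Rightarrow> nat \<Rightarrow> 'b) \<Rightarrow> (nat \<Rightarrow> 'b) \<Rightarrow> nat \<Rightarrow> (nat \<Rightarrow> nat) \<Rightarrow> nat \<Rightarrow> 'b" where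
  "tt_block M G H l s m =
     (let s' = s(0 := l) in if m = M then H (s' (m - 1)) else G m (s' (m - 1)) (s' m))"

definition tt_tensor ::
  "nat \<Rightarrow> (nat \<Rightarrow> nat) \<Rightarrow> (nat \<Rightarrow> nat \<Rightarrow> nat \<Rightarrow> nat \<Rightarrow> real) \<Rightarrow> (nat \<Rightarrow> nat \<Rightarrow> real)
     \<Rightarrow> nat \<Rightarrow> (nat \<Rightarrow> nat) \<Rightarrow> real" where
  "tt_tensor M r G H l \<alpha> = (\<Sum>s\<in>tt_indices M r. \<Prod>m=1..M. tt_block M G H l s m (\<alpha> m))"

definition K_omega ::
  "nat \<Rightarrow> (nat \<Rightarrow> nat) \<Rightarrow> ((nat \<Rightarrow> nat) \<Rightarrow> real) \<Rightarrow> (nat \<Rightarrow> nat) \<Rightarrow> (nat \<Rightarrow> nat) \<Rightarrow> real" where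
  "K_omega M p t \<alpha> \<beta> = (\<Sum>\<nu>\<in>multi_indices M p. triple_product_multi M \<alpha> \<beta> \<nu> * t \<nu>)"

definition kron ::
  "('i \<Rightarrow> 'j \<Rightarrow> real) \<Rightarrow> ('a \<Rightarrow> 'b \<Rightarrow> real) \<Rightarrow> 'i \<times> 'a \<Rightarrow> 'j \<times> 'b \<Rightarrow> real" where
  "kron A B = (\<lambda>(i, \<alpha>) (j, \<beta>). A i j * B \<alpha> \<beta>)"

(* The Kronecker product of A 1, ..., A M, indexed by multi-indices. *)
definition kron_multi ::
  "nat \<Rightarrow> (nat \<Rightarrow> nat \<Rightarrow> nat \<Rightarrow> real) \<Rightarrow> (nat \<Rightarrow> nat) \<Rightarrow> (nat \<Rightarrow> nat) \<Rightarrow> real" where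
  "kron_multi M A \<alpha> \<beta> = (\<Prod>m=1..M. A m (\<alpha> m) (\<beta> m))"

definition galerkin_matrix ::
  "('a::euclidean_space) set \<Rightarrow> (nat \<Rightarrow> 'a \<Rightarrow> real) \<Rightarrow> ('a \<Rightarrow> real) \<Rightarrow> (nat \<Rightarrow> 'a \<Rightarrow> real) \<Rightarrow> nat
     \<Rightarrow> nat \<Rightarrow> (nat \<Rightarrow> nat) \<Rightarrow> (nat \<Rightarrow> (nat \<Rightarrow> nat) \<Rightarrow> real)
     \<Rightarrow> nat \<times> (nat \<Rightarrow> nat) \<Rightarrow> nat \<times> (nat \<Rightarrow> nat) \<Rightarrow> real" where
  "galerkin_matrix D \<phi> \<kappa>bar v L M p t I J =
     kron (stiffness D \<phi> \<kappa>bar) (Delta0 M) I J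
     + (\<Sum>l=1..L. kron (stiffness D \<phi> (v l)) (K_omega M p (t l)) I J)"

end

(* For a fixed l, summing triple products against a tensor train factorises mode by
   mode, so every block G is just replaced by the matrix of its contractions with
   the triple products, and the ranks stay the same.  The term with Delta0 has the same
   shape, since the tensor with index 0 is the indicator of the zero multi-index. *)

theory Submission
  imports Defs
begin

text \<open>One-variable Galerkin matrix: its entries are those of multiplication by the Hermite
  expansion with coefficients \<open>g\<close>, tested against \<open>hermite a\<close> and
  \<open>hermite b\<close> under the Gaussian weight.\<close>

definition contract_block :: "(nat \<Rightarrow> nat) \<Rightarrow> nat \<Rightarrow> (nat \<Rightarrow> real) \<Rightarrow> nat \<Rightarrow> nat \<Rightarrow> real" where
  "contract_block p m g a b = (\<Sum>c = 0..p m. triple_product a b c * g c)"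

text \<open>Choosing a block by \<open>l\<close> and \<open>s\<close> does not look inside it, so a
  map applied to every block commutes with the choice. The separate last block is always mode
  \<open>M\<close>, hence \<open>T M\<close>.\<close>

lemma tt_block_map:
  "tt_block M (\<lambda>m a b. T m (G m a b)) (\<lambda>a. T M (H a)) l s m = T m (tt_block M G H l s m)"
  by (simp add: tt_block_def Let_def)

text \<open>For fixed \<open>s\<close> the summand is a product whose factor in mode
  \<open>m\<close> depends on \<nu> only through its entry at \<open>m\<close>. As the multi-indices
  form a full box, the sum of products is a product of sums.\<close>

lemma K_omega_tt_tensor:
  "K_omega M p (tt_tensor M r G H l) \<alpha> \<beta> =
    (\<Sum>s\<in>tt_indices M r. kron_multi M
      (tt_block M (\<lambda>m a b. contract_block p m (G m a b)) (\<lambda>a. contract_block p M (H a)) l s) \<alpha> \<beta>)"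
proof -
  have "K_omega M p (tt_tensor M r G H l) \<alpha> \<beta> =
      (\<Sum>\<nu>\<in>multi_indices M p. \<Sum>s\<in>tt_indices M r.
        \<Prod>m=1..M. triple_product (\<alpha> m) (\<beta> m) (\<nu> m) * tt_block M G H l s m (\<nu> m))"
    by (simp add: K_omega_def tt_tensor_def triple_product_multi_def sum_distrib_left prod.distrib)
  also have "\<dots> = (\<Sum>s\<in>tt_indices M r. \<Sum>\<nu>\<in>multi_indices M p.
        \<Prod>m=1..M. triple_product (\<alpha> m) (\<beta> m) (\<nu> m) * tt_block M G H l s m (\<nu> m))"
    by (rule sum.swap)
  also have "\<dots> = (\<Sum>s\<in>tt_indices M r. \<Prod>m=1..M. \<Sum>c = 0..p m.
        triple_product (\<alpha> m) (\<beta> m) c * tt_block M G H l s m c)"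
    \<comment> \<open>Distributive law over the box of multi-indices; each mode keeps its own sum
      over \<open>{0..p m}\<close>.\<close>
    by (simp add: multi_indices_def prod_sum_PiE)
  finally show ?thesis
    by (simp only: kron_multi_def tt_block_map contract_block_def)
qed

text \<open>Only the zero multi-index survives in the sum, and there every triple product has third
  index 0, as in \<open>Delta0\<close>.\<close>

lemma K_omega_indicator_zero:
  assumes "\<And>\<nu>. \<nu> \<in> multi_indices M p \<Longrightarrow> t \<nu> = (if \<forall>m\<in>{1..M}. \<nu> m = 0 then 1 else 0)"
  shows "K_omega M p t \<alpha> \<beta> = Delta0 M \<alpha> \<beta>"
proof -
  \<comment> \<open>Multi-indices are extensional, so the zero multi-index is the restriction of the
    zero function to \<open>{1..M}\<close>.\<close>
  define z :: "nat \<Rightarrow> nat" where "z = restrict (\<lambda>_. 0) {1..M}"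
  have z: "z \<in> multi_indices M p"
    by (auto simp: multi_indices_def z_def)
  have zero_iff: "(\<forall>m\<in>{1..M}. \<nu> m = 0) \<longleftrightarrow> \<nu> = z" if "\<nu> \<in> multi_indices M p" for \<nu>
    using that unfolding multi_indices_def z_def by (auto intro: PiE_ext)
  have "K_omega M p t \<alpha> \<beta> =
      (\<Sum>\<nu>\<in>multi_indices M p. if \<nu> = z then triple_product_multi M \<alpha> \<beta> \<nu> else 0)"
    unfolding K_omega_def by (rule sum.cong) (simp_all only: assms zero_iff, simp)
  also have "\<dots> = triple_product_multi M \<alpha> \<beta> z"
    using z by (simp add: multi_indices_def finite_PiE)
  also have "\<dots> = Delta0 M \<alpha> \<beta>"
    by (simp add: triple_product_multi_def Delta0_def z_def)
  finally show ?thesis .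
qed

theorem lemma8:
  fixes M L N :: nat
    and p r :: "nat \<Rightarrow> nat"
    and D :: "(real ^ 'd) set"
    and \<phi> :: "nat \<Rightarrow> real ^ 'd \<Rightarrow> real"
    and \<kappa>bar :: "real ^ 'd \<Rightarrow> real"
    and v :: "nat \<Rightarrow> real ^ 'd \<Rightarrow> real"
    and \<kappa> :: "real ^ 'd \<Rightarrow> (nat \<Rightarrow> nat) \<Rightarrow> real"
    and \<kappa>0 :: "nat \<Rightarrow> real ^ 'd \<Rightarrow> real"
    and G :: "nat \<Rightarrow> nat \<Rightarrow> nat \<Rightarrow> nat \<Rightarrow> real"
    and H :: "nat \<Rightarrow> nat \<Rightarrow> real"
  assumes "M \<ge> 1" and "L \<ge> 1" and "N \<ge> 1"
    and domain: "open D" "connected D" "D \<noteq> {}"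
    and basis_diff: "\<And>i. i \<in> {1..N} \<Longrightarrow> AE x in lebesgue_on D. \<phi> i differentiable (at x)"
    and basis_indep: "\<And>c. (\<forall>x\<in>D. (\<Sum>i=1..N. c i * \<phi> i x) = 0) \<Longrightarrow> \<forall>i\<in>{1..N}. c i = 0"
    and finite_mean: "\<And>i j. i \<in> {1..N} \<Longrightarrow> j \<in> {1..N} \<Longrightarrow>
          set_integrable lebesgue D (\<lambda>x. \<kappa>bar x * (grad (\<phi> i) x \<bullet> grad (\<phi> j) x))"
    and finite_KL: "\<And>l i j. l \<in> {1..L} \<Longrightarrow> i \<in> {1..N} \<Longrightarrow> j \<in> {1..N} \<Longrightarrow>
          set_integrable lebesgue D (\<lambda>x. v l x * (grad (\<phi> i) x \<bullet> grad (\<phi> j) x))"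
    and \<kappa>_tt: "\<And>x \<alpha>. x \<in> D \<Longrightarrow> \<alpha> \<in> multi_indices M p \<Longrightarrow>
          \<kappa> x \<alpha> = (\<Sum>l=0..L. \<Sum>s\<in>tt_indices M r.
                     \<kappa>0 l x * (\<Prod>m=1..M. tt_block M G H l s m (\<alpha> m)))"
    and \<kappa>0_mean: "\<kappa>0 0 = \<kappa>bar"
    and \<kappa>0_KL: "\<And>l. l \<in> {1..L} \<Longrightarrow> \<kappa>0 l = v l"
    and tensor_0: "\<And>\<alpha>. \<alpha> \<in> multi_indices M p \<Longrightarrow>
          tt_tensor M r G H 0 \<alpha> = (if \<forall>m\<in>{1..M}. \<alpha> m = 0 then 1 else 0)"
  shows "\<exists>(K0 :: nat \<Rightarrow> nat \<Rightarrow> nat \<Rightarrow> real)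
          (K :: nat \<Rightarrow> nat \<Rightarrow> nat \<Rightarrow> nat \<Rightarrow> nat \<Rightarrow> real)
          (K_last :: nat \<Rightarrow> nat \<Rightarrow> nat \<Rightarrow> real).
         \<forall>I \<in> {1..N} \<times> multi_indices M p. \<forall>J \<in> {1..N} \<times> multi_indices M p.
           galerkin_matrix D \<phi> \<kappa>bar v L M p (tt_tensor M r G H) I J
           = (\<Sum>l=0..L. \<Sum>s\<in>tt_indices M r.
                kron (K0 l) (kron_multi M (tt_block M K K_last l s)) I J)"
proof -
  define K where "K = (\<lambda>m a b. contract_block p m (G m a b))"
  define K_last where "K_last = (\<lambda>a. contract_block p M (H a))"
  \<comment> \<open>Using \<open>\<kappa>0\<close> puts the mean at index 0 and the functions
    \<open>v l\<close> at the others.\<close>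
  define K0 where "K0 = (\<lambda>l. stiffness D \<phi> (\<kappa>0 l))"
  define t where "t = tt_tensor M r G H"
  have "galerkin_matrix D \<phi> \<kappa>bar v L M p t I J
      = (\<Sum>l=0..L. \<Sum>s\<in>tt_indices M r.
           kron (K0 l) (kron_multi M (tt_block M K K_last l s)) I J)" for I J
  proof -
    obtain i \<alpha> j \<beta> where IJ: "I = (i, \<alpha>)" "J = (j, \<beta>)"
      by (cases I, cases J)
    \<comment> \<open>This makes the mean term the summand \<open>l = 0\<close>, so that one sum
      over \<open>{0..L}\<close> covers the whole matrix.\<close>
    have "Delta0 M = K_omega M p (t 0)"
      unfolding t_def using K_omega_indicator_zero[OF tensor_0] by (intro ext) simp
    then have "galerkin_matrix D \<phi> \<kappa>bar v L M p t I J
        = (\<Sum>l=0..L. kron (K0 l) (K_omega M p (t l)) I J)"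
      by (simp add: galerkin_matrix_def K0_def \<kappa>0_mean \<kappa>0_KL sum.atLeast_Suc_atMost)
    also have "\<dots> = (\<Sum>l=0..L. \<Sum>s\<in>tt_indices M r.
           kron (K0 l) (kron_multi M (tt_block M K K_last l s)) I J)"
      \<comment> \<open>Linearity of \<open>kron\<close> in its second factor moves the sum over
        \<open>s\<close> outside.\<close>
      by (simp add: IJ kron_def t_def K_omega_tt_tensor sum_distrib_left K_def K_last_def)
    finally show ?thesis .
  qed
  then show ?thesis
    unfolding t_def by blast
qed

end
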